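(* Let $F=(f_{ij})_{1\le i,j\le 4}$ be a lift of the $4\times 4$ identity valuation pattern over a valued field whose residue field $k$ has characteristic $\ne 3$, with off-diagonal residues $U=(u_{ij})_{i\ne j}$. If all admissible residue cross-ratios $\rho_{ij}^{ab}$ of this block are equal to $1$, then the off-diagonal residues factor as rank $1$ (there are $\alpha_i,\beta_j\in k^*$ with $u_{ij}=\alpha_i\beta_j$ for all $i\neq j$), the leading derangement equation $\Theta_4(U)=0$ fails, and therefore $\det(F)\ne 0$. Equivalently, if $\det(F)=0$ then there is at least one admissible rectangle with $\rho_{ij}^{ab}\ne 1$.
   Context: $(K,\mathrm{val})$ is a non-archimedean valued field with value group in $\mathbb R$, valuation ring $R_K$, maximal ideal $\mathfrak m_K$ and residue field $k=R_K/\mathfrak m_K$. A lift of the $4\times4$ identity valuation pattern is a matrix $F=(f_{ij})\in K^{4\times4}$ with $\mathrm{val}(f_{ii})=1$ for all $i$ and $\mathrm{val}(f_{ij})=0$ for $i\neq j$. Its off-diagonal residues are $u_{ij}:=f_{ij}\bmod\mathfrak m_K\in k^*$ for $i\ne j$. Let $D_4\subset S_4$ be the set of derangements and $\Theta_4(U):=\sum_{\sigma\in D_4}\mathrm{sgn}(\sigma)\prod_{i=1}^4 u_{i,\sigma(i)}\in k$. For distinct rows $i\ne j$ and distinct columns $a\ne b$ with $\{i,j\}\cap\{a,b\}=\varnothing$, the admissible cross-ratio (of the admissible rectangle $\{i,j\}\times\{a,b\}$) is $\rho_{ij}^{ab}:=\dfrac{u_{ia}u_{jb}}{u_{ib}u_{ja}}\in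 k^*$. *)

theory Defs
  imports
    "HOL-Algebra.QuotRing"
    "HOL-Algebra.Multiplicative_Group"
    "HOL-Combinatorics.Permutations"
    "HOL-Library.Extended_Real"
begin

text \<open>A field with a valuation in \<open>\<real> \<union> {\<infinity>}\<close>, the value \<open>\<infinity>\<close> being taken exactly at zero.\<close>

locale valued_field = field K for K (structure) +
  fixes val :: "'a \<Rightarrow> ereal"
  assumes val_not_minus_infinity: "x \<in> carrier K \<Longrightarrow> val x \<noteq> -\<infinity>"
    and val_eq_infinity_iff: "x \<in> carrier K \<Longrightarrow> val x = \<infinity> \<longleftrightarrow> x = \<zero>"
    and val_mult: "\<lbrakk>x \<in> carrier K; y \<in> carrier K\<rbrakk> \<Longrightarrow> val (x \<otimes> y) = val x + val y"
    and val_add: "\<lbrakk>x \<in> carrier K; y \<in> carrier K\<rbrakk> \<Longrightarrow> min (val x) (val y) \<le> val (x \<oplus> y)"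

definition valuation_ring :: "('a, 'm) ring_scheme \<Rightarrow> ('a \<Rightarrow> ereal) \<Rightarrow> ('a, 'm) ring_scheme" where
  "valuation_ring K val = K\<lparr>carrier := {x \<in> carrier K. 0 \<le> val x}\<rparr>"

definition valuation_ideal :: "('a, 'm) ring_scheme \<Rightarrow> ('a \<Rightarrow> ereal) \<Rightarrow> 'a set" where
  "valuation_ideal K val = {x \<in> carrier K. 0 < val x}"

definition residue_field :: "('a, 'm) ring_scheme \<Rightarrow> ('a \<Rightarrow> ereal) \<Rightarrow> 'a set ring" where
  "residue_field K val = valuation_ring K val Quot valuation_ideal K val"

text \<open>Reduction modulo the maximal ideal; meaningful only for \<open>x\<close> in the valuation ring.\<close>

definition residue :: "('a, 'm) ring_scheme \<Rightarrow> ('a \<Rightarrow> ereal) \<Rightarrow> 'a \<Rightarrow> 'a set" where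
  "residue K val x = valuation_ideal K val +>\<^bsub>valuation_ring K val\<^esub> x"

text \<open>\<open>group.ord\<close> is \<open>0\<close> for elements of infinite order, so this is the usual characteristic.\<close>

definition ring_characteristic :: "('a, 'm) ring_scheme \<Rightarrow> nat" where
  "ring_characteristic R = group.ord (add_monoid R) \<one>\<^bsub>R\<^esub>"

text \<open>Matrices are functions on pairs of indices, of which only the values on
  \<open>{1..n} \<times> {1..n}\<close> matter.  The Leibniz sum over a set \<open>S\<close> of permutations gives the
  determinant when \<open>S\<close> is the whole symmetric group.\<close>

definition leibniz_sum ::
    "('a, 'm) ring_scheme \<Rightarrow> nat \<Rightarrow> (nat \<Rightarrow> nat) set \<Rightarrow> (nat \<Rightarrow> nat \<Rightarrow> 'a) \<Rightarrow> 'a" where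
  "leibniz_sum R n S A =
     (\<Oplus>\<^bsub>R\<^esub>\<sigma>\<in>S. [sign \<sigma>] \<cdot>\<^bsub>R\<^esub> (\<Otimes>\<^bsub>R\<^esub>i\<in>{1..n}. A i (\<sigma> i)))"

definition matrix_det :: "('a, 'm) ring_scheme \<Rightarrow> nat \<Rightarrow> (nat \<Rightarrow> nat \<Rightarrow> 'a) \<Rightarrow> 'a" where
  "matrix_det R n A = leibniz_sum R n {\<sigma>. \<sigma> permutes {1..n}} A"

definition derangements :: "nat \<Rightarrow> (nat \<Rightarrow> nat) set" where
  "derangements n = {\<sigma>. \<sigma> permutes {1..n} \<and> (\<forall>i\<in>{1..n}. \<sigma> i \<noteq> i)}"

definition Theta4 :: "('a, 'm) ring_scheme \<Rightarrow> (nat \<Rightarrow> nat \<Rightarrow> 'a) \<Rightarrow> 'a" where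
  "Theta4 k U = leibniz_sum k 4 (derangements 4) U"

definition identity_pattern_lift ::
    "('a, 'm) ring_scheme \<Rightarrow> ('a \<Rightarrow> ereal) \<Rightarrow> (nat \<Rightarrow> nat \<Rightarrow> 'a) \<Rightarrow> bool" where
  "identity_pattern_lift K val F \<longleftrightarrow>
     (\<forall>i\<in>{1..4}. \<forall>j\<in>{1..4}. F i j \<in> carrier K \<and> val (F i j) = (if i = j then 1 else 0))"

definition admissible :: "nat \<Rightarrow> nat \<Rightarrow> nat \<Rightarrow> nat \<Rightarrow> bool" where
  "admissible i j a b \<longleftrightarrow>
     {i, j, a, b} \<subseteq> {1..4} \<and> i \<noteq> j \<and> a \<noteq> b \<and> {i, j} \<inter> {a, b} = {}"

definition cross_ratio ::
    "('a, 'm) ring_scheme \<Rightarrow> (nat \<Rightarrow> nat \<Rightarrow> 'a) \<Rightarrow> nat \<Rightarrow> nat \<Rightarrow> nat \<Rightarrow> nat \<Rightarrow> 'a" where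
  "cross_ratio k U i j a b =
     (U i a \<otimes>\<^bsub>k\<^esub> U j b) \<otimes>\<^bsub>k\<^esub> inv\<^bsub>k\<^esub> (U i b \<otimes>\<^bsub>k\<^esub> U j a)"

end

theory Submission
  imports Defs "HOL-Algebra.Subrings"
begin

text \<open>Trivial cross-ratios around the six admissible rectangles force the off-diagonal residues to
  factor as \<open>\<alpha>\<^sub>i \<beta>\<^sub>j\<close>, so every derangement contributes \<open>\<plusminus>\<Prod>\<alpha>\<^sub>i \<Prod>\<beta>\<^sub>j\<close> to \<open>\<Theta>\<^sub>4\<close>.  The six
  four-cycles are odd and the three double transpositions even, hence \<open>\<Theta>\<^sub>4 = -3 \<Prod>\<alpha>\<^sub>i \<Prod>\<beta>\<^sub>j \<noteq> 0\<close>.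
  As the diagonal entries reduce to zero, \<open>\<Theta>\<^sub>4\<close> is the residue of the determinant.\<close>

section \<open>Leibniz sums over commutative rings\<close>

text \<open>Needed for two homomorphisms out of the valuation ring: the inclusion into the field and
  the reduction to the residue field.\<close>

lemma (in ring_hom_cring) hom_leibniz_sum:
  assumes A: "\<And>\<sigma> i. \<lbrakk>\<sigma> \<in> I; i \<in> {1..n}\<rbrakk> \<Longrightarrow> A i (\<sigma> i) \<in> carrier R"
  shows "h (leibniz_sum R n I A) = leibniz_sum S n I (\<lambda>i j. h (A i j))"
proof -
  have prod: "(\<Otimes>\<^bsub>R\<^esub>i\<in>{1..n}. A i (\<sigma> i)) \<in> carrier R"
    "h (\<Otimes>\<^bsub>R\<^esub>i\<in>{1..n}. A i (\<sigma> i)) = (\<Otimes>\<^bsub>S\<^esub>i\<in>{1..n}. h (A i (\<sigma> i)))"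
    if "\<sigma> \<in> I" for \<sigma>
    using A that by (auto simp: hom_finprod Pi_def comp_def)
  have int_pow: "h ([sign \<sigma>] \<cdot>\<^bsub>R\<^esub> x) = [sign \<sigma>] \<cdot>\<^bsub>S\<^esub> h x"
    if "x \<in> carrier R" for x and \<sigma> :: "nat \<Rightarrow> nat"
    using that by (simp add: sign_def R.add.int_pow_neg S.add.int_pow_neg)
  have "h (leibniz_sum R n I A) =
      (\<Oplus>\<^bsub>S\<^esub>\<sigma>\<in>I. h ([sign \<sigma>] \<cdot>\<^bsub>R\<^esub> (\<Otimes>\<^bsub>R\<^esub>i\<in>{1..n}. A i (\<sigma> i))))"
    unfolding leibniz_sum_def using prod by (subst hom_finsum) (auto simp: comp_def)
  also have "\<dots> = leibniz_sum S n I (\<lambda>i j. h (A i j))"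
    unfolding leibniz_sum_def using prod A
    by (intro S.finsum_cong') (auto simp: int_pow intro!: S.add.int_pow_closed S.finprod_closed)
  finally show ?thesis .
qed

text \<open>Every permutation meets each row and each column once, so all terms share one product
  and only the signs are left to add. The factorization is asked for only at positions visited by
  \<open>S\<close>; for derangements this leaves the diagonal free.\<close>

lemma (in cring) leibniz_sum_rank_one:
  assumes "finite S" and S: "\<And>\<sigma>. \<sigma> \<in> S \<Longrightarrow> \<sigma> permutes {1..n}"
    and \<alpha>: "\<alpha> \<in> {1..n} \<rightarrow> carrier R" and \<beta>: "\<beta> \<in> {1..n} \<rightarrow> carrier R"
    and A: "\<And>\<sigma> i. \<lbrakk>\<sigma> \<in> S; i \<in> {1..n}\<rbrakk> \<Longrightarrow> A i (\<sigma> i) = \<alpha> i \<otimes> \<beta> (\<sigma> i)"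
  shows "leibniz_sum R n S A =
    [sum sign S] \<cdot> ((\<Otimes>i\<in>{1..n}. \<alpha> i) \<otimes> (\<Otimes>i\<in>{1..n}. \<beta> i))"
proof -
  define P where "P = (\<Otimes>i\<in>{1..n}. \<alpha> i) \<otimes> (\<Otimes>i\<in>{1..n}. \<beta> i)"
  have P: "P \<in> carrier R"
    unfolding P_def using \<alpha> \<beta> by auto
  have term_eq: "(\<Otimes>i\<in>{1..n}. A i (\<sigma> i)) = P" if "\<sigma> \<in> S" for \<sigma>
  proof -
    have perm: "\<sigma> permutes {1..n}" using S that by blast
    have img: "\<sigma> ` {1..n} = {1..n}" and inj: "inj_on \<sigma> {1..n}"
      using perm by (auto simp: permutes_image permutes_inj_on)
    have \<beta>\<sigma>: "(\<lambda>i. \<beta> (\<sigma> i)) \<in> {1..n} \<rightarrow> carrier R"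
      using img \<beta> by blast
    have "(\<Otimes>i\<in>{1..n}. A i (\<sigma> i)) = (\<Otimes>i\<in>{1..n}. \<alpha> i \<otimes> \<beta> (\<sigma> i))"
      using \<alpha> \<beta>\<sigma> A[OF that] by (intro finprod_cong') auto
    also have "\<dots> = (\<Otimes>i\<in>{1..n}. \<alpha> i) \<otimes> (\<Otimes>i\<in>{1..n}. \<beta> (\<sigma> i))"
      using \<alpha> \<beta>\<sigma> by (rule finprod_multf)
    also have "(\<Otimes>i\<in>{1..n}. \<beta> (\<sigma> i)) = (\<Otimes>i\<in>{1..n}. \<beta> i)"
      using finprod_reindex[of \<beta> \<sigma> "{1..n}"] img inj \<beta> by simp
    finally show ?thesis unfolding P_def .
  qed
  have "leibniz_sum R n S A = (\<Oplus>\<sigma>\<in>S. [sign \<sigma>] \<cdot> P)"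
    unfolding leibniz_sum_def using P by (intro finsum_cong') (auto simp: term_eq simp del: One_nat_def)
  also have "\<dots> = [sum sign S] \<cdot> P"
    using \<open>finite S\<close>
  proof induction
    case empty
    show ?case by (simp add: add_pow_def)
  next
    case (insert \<sigma> I)
    then show ?case using P by (simp add: add.int_pow_mult)
  qed
  finally show ?thesis unfolding P_def .
qed

text \<open>A permutation with a fixed point \<open>j\<close> picks up the zero factor
  \<open>A j j\<close>, so only derangements contribute.\<close>

lemma (in cring) matrix_det_hollow:
  assumes A: "\<And>i j. \<lbrakk>i \<in> {1..n}; j \<in> {1..n}\<rbrakk> \<Longrightarrow> A i j \<in> carrier R"
    and diag: "\<And>i. i \<in> {1..n} \<Longrightarrow> A i i = \<zero>"
  shows "matrix_det R n A = leibniz_sum R n (derangements n) A"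
proof -
  have carr: "A i (\<sigma> i) \<in> carrier R" if "\<sigma> permutes {1..n}" "i \<in> {1..n}" for \<sigma> i
    using A that permutes_in_image[OF that(1)] by blast
  have zero: "(\<Otimes>i\<in>{1..n}. A i (\<sigma> i)) = \<zero>"
    if \<sigma>: "\<sigma> permutes {1..n}" and fixpoint: "\<sigma> \<notin> derangements n" for \<sigma>
  proof -
    obtain j where j: "j \<in> {1..n}" "\<sigma> j = j"
      using \<sigma> fixpoint unfolding derangements_def by blast
    have "(\<Otimes>i\<in>insert j ({1..n} - {j}). A i (\<sigma> i)) =
        A j (\<sigma> j) \<otimes> (\<Otimes>i\<in>{1..n} - {j}. A i (\<sigma> i))"
      using carr[OF \<sigma>] A[OF j(1) j(1)] j(2) by (intro finprod_insert) auto
    also have "\<dots> = \<zero>"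
      using diag[OF j(1)] j carr[OF \<sigma>] by (simp add: Pi_def)
    finally show ?thesis using j by (simp add: insert_absorb)
  qed
  show ?thesis
    unfolding matrix_det_def leibniz_sum_def
  proof (rule add.finprod_mono_neutral_cong_right)
    show "finite {\<sigma>. \<sigma> permutes {1..n}}"
      by (simp add: finite_permutations)
    show "(\<lambda>\<sigma>. [sign \<sigma>] \<cdot> (\<Otimes>i\<in>{1..n}. A i (\<sigma> i)))
        \<in> {\<sigma>. \<sigma> permutes {1..n}} \<rightarrow> carrier R"
      using carr by (auto intro!: add.int_pow_closed finprod_closed)
    show "[sign \<sigma>] \<cdot> (\<Otimes>i\<in>{1..n}. A i (\<sigma> i)) = \<zero>"
      if "\<sigma> \<in> {\<sigma>. \<sigma> permutes {1..n}} - derangements n" for \<sigma>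
      using zero[of \<sigma>] that by (simp add: add.int_pow_one)
  qed (auto simp: derangements_def)
qed

lemma sum_sign_derangements_4: "(\<Sum>\<sigma>\<in>derangements 4. sign \<sigma>) = -3"
proof -
  have set4: "{1..4::nat} = {1, 2, 3, 4}" by auto
  \<comment> \<open>Extending the summand by 0 to all permutations allows
    \<open>sum_over_permutations_insert\<close> to unfold the sum one index at a time.\<close>
  define f where "f \<sigma> = (if \<forall>i\<in>{1, 2, 3, 4}. \<sigma> i \<noteq> i then sign \<sigma> else 0)"
    for \<sigma> :: "nat \<Rightarrow> nat"
  have "(\<Sum>\<sigma>\<in>derangements 4. sign \<sigma>) = sum f {\<sigma>. \<sigma> permutes {1, 2, 3, 4}}"
    unfolding derangements_def f_def set4
    by (rule sum.mono_neutral_cong_left) (auto simp: finite_permutations)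
  also have "\<dots> = -3"
    by (simp add: sum_over_permutations_insert del: One_nat_def)
      (simp add: f_def transpose_def sign_compose sign_swap_id permutation_swap_id
        permutation_compose ex_disj_distrib del: One_nat_def)
  finally show ?thesis .
qed

section \<open>Rank-one factorization off the diagonal\<close>

text \<open>Solves a rectangle equation for one corner, in the shape row factor times column
  factor.\<close>

lemma (in field) mult_inv_mult_eqI:
  assumes "u \<in> carrier R" "x \<in> carrier R" "y \<in> carrier R" "z \<in> carrier R" "z \<noteq> \<zero>"
    and "u \<otimes> z = x \<otimes> y"
  shows "u = (x \<otimes> inv z) \<otimes> y"
proof -
  have z: "inv z \<in> carrier R" "z \<otimes> inv z = \<one>" "inv z \<otimes> z = \<one>"
    using assms field_Units by auto
  have "u = u \<otimes> z \<otimes> inv z"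
    using assms(1,4) z by (simp add: m_assoc)
  also have "\<dots> = (x \<otimes> y) \<otimes> inv z"
    using assms(6) by simp
  also have "\<dots> = (x \<otimes> inv z) \<otimes> y"
    using assms(2,3) z(1) by (simp add: m_ac)
  finally show ?thesis .
qed

lemma (in field) cross_ratio_eq_oneD:
  assumes "cross_ratio R U i j a b = \<one>"
    and "U i a \<in> carrier R" "U j b \<in> carrier R"
    and "U i b \<in> carrier R - {\<zero>}" "U j a \<in> carrier R - {\<zero>}"
  shows "U i a \<otimes> U j b = U i b \<otimes> U j a"
proof -
  have "U i b \<otimes> U j a \<in> Units R"
    using assms field_Units by (simp add: integral_iff)
  moreover from this have "(U i a \<otimes> U j b) \<otimes> inv (U i b \<otimes> U j a) \<otimes> (U i b \<otimes> U j a) = U i a \<otimes> U j b"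
    using assms by (simp add: m_assoc)
  ultimately show ?thesis
    using assms(1) by (simp add: cross_ratio_def Units_closed)
qed

text \<open>The off-diagonal positions are the edges of a cube graph (rows against columns) and the
  admissible rectangles are its six faces, which generate its cycle space.  The entries
  \<open>12, 13, 14, 21, 23, 32, 42\<close> form the spanning tree from which \<open>\<alpha>\<close> and \<open>\<beta>\<close> are read off,
  normalized by \<open>\<alpha> 1 = \<one>\<close>.\<close>

lemma (in field) rank_one_off_diagonal:
  assumes U: "\<And>i j. \<lbrakk>i \<in> {1..4}; j \<in> {1..4}; i \<noteq> j\<rbrakk> \<Longrightarrow> U i j \<in> carrier R - {\<zero>}"
    and cr: "\<And>i j a b. admissible i j a b \<Longrightarrow> cross_ratio R U i j a b = \<one>"
  shows "\<exists>\<alpha> \<beta>. (\<forall>i\<in>{1..4}. \<alpha> i \<in> Units R \<and> \<beta> i \<in> Units R) \<and>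
    (\<forall>i\<in>{1..4}. \<forall>j\<in>{1..4}. i \<noteq> j \<longrightarrow> U i j = \<alpha> i \<otimes> \<beta> j)"
proof -
  have set4: "{1..4::nat} = {1, 2, 3, 4}" by auto
  have carr: "U i j \<in> carrier R" and nz: "U i j \<noteq> \<zero>" and unit: "U i j \<in> Units R"
    if "i \<in> {1..4}" "j \<in> {1..4}" "i \<noteq> j" for i j
    using U[OF that] field_Units by auto
  have rect: "U i a \<otimes> U j b = U i b \<otimes> U j a" if adm: "admissible i j a b" for i j a b
    by (rule cross_ratio_eq_oneD[OF cr[OF adm]])
      (use adm U in \<open>auto simp: admissible_def simp del: atLeastAtMost_iff\<close>)
  define a2 a3 a4 where "a2 = U 2 3 \<otimes> inv (U 1 3)" and "a3 = U 3 2 \<otimes> inv (U 1 2)"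
    and "a4 = U 4 2 \<otimes> inv (U 1 2)"
  \<comment> \<open>Row 1 has only a diagonal entry in column 1, so this column factor is read off
    from row 2.\<close>
  define b1 where "b1 = U 2 1 \<otimes> inv a2"
  have a_unit: "a2 \<in> Units R" "a3 \<in> Units R" "a4 \<in> Units R"
    unfolding a2_def a3_def a4_def by (simp_all add: unit)
  have b_unit: "b1 \<in> Units R"
    unfolding b1_def by (simp add: unit a_unit)
  have a_nz: "a2 \<in> carrier R" "a2 \<noteq> \<zero>" "a3 \<in> carrier R" "a4 \<in> carrier R"
    using a_unit field_Units by auto
  note eqI = mult_inv_mult_eqI
  \<comment> \<open>In each of the rows 2, 3, 4 the ratio to row 1 is defined in one column, which
    gives the first equation; the rectangle on row 1 and that row carries the ratio over to the
    other column.\<close>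
  have 23: "U 2 3 = a2 \<otimes> U 1 3" and 24: "U 2 4 = a2 \<otimes> U 1 4"
    unfolding a2_def using rect[of 1 2 3 4]
    by (intro eqI; simp add: carr nz admissible_def m_comm)+
  have 32: "U 3 2 = a3 \<otimes> U 1 2" and 34: "U 3 4 = a3 \<otimes> U 1 4"
    unfolding a3_def using rect[of 1 3 2 4]
    by (intro eqI; simp add: carr nz admissible_def m_comm)+
  have 42: "U 4 2 = a4 \<otimes> U 1 2" and 43: "U 4 3 = a4 \<otimes> U 1 3"
    unfolding a4_def using rect[of 1 4 2 3]
    by (intro eqI; simp add: carr nz admissible_def m_comm)+
  have 21: "U 2 1 = a2 \<otimes> b1"
    unfolding b1_def using eqI[of "U 2 1" "U 2 1" a2 a2] carr a_nz a_unit by (simp add: m_comm)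
  \<comment> \<open>The entries 31 and 41 come from rectangles joining row 2 to rows 3 and 4.
    Inserting the factorizations already found leaves a common entry of row 1 to cancel.\<close>
  have "(U 3 1 \<otimes> a2) \<otimes> U 1 4 = (U 2 1 \<otimes> a3) \<otimes> U 1 4"
    using rect[of 2 3 1 4] 24 34 carr a_nz by (simp add: admissible_def m_ac)
  then have "U 3 1 \<otimes> a2 = U 2 1 \<otimes> a3"
    using m_rcancel[of "U 1 4" "U 3 1 \<otimes> a2" "U 2 1 \<otimes> a3"] carr nz a_nz by simp
  then have 31: "U 3 1 = a3 \<otimes> b1"
    unfolding b1_def using eqI[of "U 3 1" "U 2 1" a3 a2] carr a_nz a_unit by (simp add: m_comm)
  have "(U 4 1 \<otimes> a2) \<otimes> U 1 3 = (U 2 1 \<otimes> a4) \<otimes> U 1 3"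
    using rect[of 2 4 1 3] 23 43 carr a_nz by (simp add: admissible_def m_ac)
  then have "U 4 1 \<otimes> a2 = U 2 1 \<otimes> a4"
    using m_rcancel[of "U 1 3" "U 4 1 \<otimes> a2" "U 2 1 \<otimes> a4"] carr nz a_nz by simp
  then have 41: "U 4 1 = a4 \<otimes> b1"
    unfolding b1_def using eqI[of "U 4 1" "U 2 1" a4 a2] carr a_nz a_unit by (simp add: m_comm)
  define \<alpha> where "\<alpha> i = (if i = 1 then \<one> else if i = 2 then a2 else if i = 3 then a3 else a4)"
    for i :: nat
  define \<beta> where "\<beta> j = (if j = 1 then b1 else U 1 j)" for j
  have "\<forall>i\<in>{1..4}. \<alpha> i \<in> Units R \<and> \<beta> i \<in> Units R"
    using a_unit b_unit unit by (simp add: \<alpha>_def \<beta>_def)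
  moreover have "\<forall>i\<in>{1..4}. \<forall>j\<in>{1..4}. i \<noteq> j \<longrightarrow> U i j = \<alpha> i \<otimes> \<beta> j"
    unfolding set4 \<alpha>_def \<beta>_def using 21 23 24 31 32 34 41 42 43 carr by simp
  ultimately show ?thesis by blast
qed

section \<open>Reduction modulo the maximal ideal\<close>

context valued_field
begin

lemma val_one: "val \<one> = 0"
proof -
  have "val \<one> = val \<one> + val \<one>" using val_mult[of \<one> \<one>] by simp
  \<comment> \<open>In \<open>ereal\<close>, v = v + v also has infinite solutions, which must be
    excluded.\<close>
  moreover have "\<bar>val \<one>\<bar> \<noteq> \<infinity>"
    using val_not_minus_infinity[of \<one>] val_eq_infinity_iff[of \<one>] by auto
  ultimately show ?thesis by (cases "val \<one>") auto
qed

text \<open>The square of -1 is 1, so twice the value of -1 is 0.\<close>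

lemma val_uminus:
  assumes "x \<in> carrier K"
  shows "val (\<ominus> x) = val x"
proof -
  have "val (\<ominus> \<one>) + val (\<ominus> \<one>) = 0"
    using val_mult[of "\<ominus> \<one>" "\<ominus> \<one>"] by (simp add: val_one l_minus)
  then have "val (\<ominus> \<one>) = 0"
    by (cases "val (\<ominus> \<one>)") auto
  then show ?thesis
    using val_mult[of "\<ominus> \<one>" x] assms by (simp add: l_minus)
qed

lemma val_zero: "val \<zero> = \<infinity>"
  by (simp add: val_eq_infinity_iff)

abbreviation "V \<equiv> valuation_ring K val"
abbreviation "M \<equiv> valuation_ideal K val"

lemma valuation_ring_simps [simp]:
  "carrier V = {x \<in> carrier K. 0 \<le> val x}"
  "monoid.mult V = monoid.mult K" "ring.add V = ring.add K" "monoid.one V = monoid.one K" "ring.zero V = ring.zero K"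
  by (simp_all add: valuation_ring_def)

lemma valuation_ring_subring: "subring {x \<in> carrier K. 0 \<le> val x} K"
proof (rule subringI)
  fix x y assume x: "x \<in> {x \<in> carrier K. 0 \<le> val x}" and y: "y \<in> {x \<in> carrier K. 0 \<le> val x}"
  then show "x \<oplus> y \<in> {x \<in> carrier K. 0 \<le> val x}"
    using val_add[of x y] by (auto simp: min_def split: if_splits)
  show "x \<otimes> y \<in> {x \<in> carrier K. 0 \<le> val x}"
    using x y by (simp add: val_mult)
qed (auto simp: val_one val_uminus)

lemma valuation_ring_cring: "cring V"
  using subcring_iff[of "{x \<in> carrier K. 0 \<le> val x}"] subcringI'[OF valuation_ring_subring]
  by (auto simp: valuation_ring_def)

lemma valuation_ring_inclusion: "ring_hom_cring V K id"
  by (intro ring_hom_cring.intro ring_hom_cring_axioms.intro valuation_ring_cring is_cring ring_hom_memI) auto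

text \<open>An element of the valuation ring outside \<open>M\<close> has value 0, hence so does its
  inverse; an ideal strictly above \<open>M\<close> therefore contains 1.\<close>

lemma valuation_ideal_maximal: "maximalideal M V"
proof -
  interpret V: cring V by (rule valuation_ring_cring)
  have "subgroup M (add_monoid V)"
  proof (rule V.add.subgroupI)
    fix x assume x: "x \<in> M"
    \<comment> \<open>Negation in \<open>V\<close> is defined relative to the smaller carrier and
      has to be identified with negation in \<open>K\<close>.\<close>
    have "\<ominus>\<^bsub>V\<^esub> x = \<ominus> x"
      using x by (intro V.minus_equality) (auto simp: valuation_ideal_def val_uminus l_neg)
    then show "\<ominus>\<^bsub>V\<^esub> x \<in> M"
      using x by (auto simp: valuation_ideal_def val_uminus)
  next
    fix x y assume "x \<in> M" "y \<in> M"
    then show "x \<oplus>\<^bsub>V\<^esub> y \<in> M"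
      using val_add[of x y] by (auto simp: valuation_ideal_def min_def split: if_splits)
  next
    have "\<zero> \<in> M" by (simp add: valuation_ideal_def val_zero)
    then show "M \<noteq> {}" by blast
  qed (auto simp: valuation_ideal_def)
  then have ideal: "ideal M V"
    by (intro idealI V.ring_axioms)
      (auto simp: valuation_ideal_def val_mult intro: add_pos_nonneg add_nonneg_pos)
  show ?thesis
  proof (rule maximalidealI[OF ideal])
    have "\<one> \<in> carrier V" "\<one> \<notin> M" by (simp_all add: valuation_ideal_def val_one)
    then show "carrier V \<noteq> M" by blast
  next
    fix J assume J: "ideal J V" "M \<subseteq> J" "J \<subseteq> carrier V"
    interpret J: ideal J V by fact
    show "J = M \<or> J = carrier V"
    proof (cases "J = M")
      case False
      then obtain x where x: "x \<in> J" "x \<notin> M" using J by blast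
      then have xK: "x \<in> carrier K" "val x = 0"
        using J(3) by (auto simp: valuation_ideal_def)
      then have "x \<noteq> \<zero>" using val_zero by auto
      then have inv: "inv x \<in> carrier K" "inv x \<otimes> x = \<one>"
        using xK field_Units by auto
      then have "val (inv x) = 0"
        using val_mult[of "inv x" x] xK val_one by simp
      then have "inv x \<otimes>\<^bsub>V\<^esub> x \<in> J"
        using J.I_l_closed[OF x(1), of "inv x"] inv by simp
      then have "\<one>\<^bsub>V\<^esub> \<in> J" using inv by simp
      then show ?thesis using J.one_imp_carrier by blast
    qed simp
  qed
qed

lemma residue_field_field: "field (residue_field K val)"
  unfolding residue_field_def
  by (rule maximalideal.quotient_is_field[OF valuation_ideal_maximal valuation_ring_cring])

lemma residue_hom: "ring_hom_cring V (residue_field K val) (residue K val)"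
  using ideal.rcos_ring_hom_cring[OF maximalideal.axioms(1)[OF valuation_ideal_maximal] valuation_ring_cring]
  by (simp add: residue_field_def residue_def[abs_def])

lemma residue_eq_zero_iff:
  assumes "x \<in> carrier K" "0 \<le> val x"
  shows "residue K val x = \<zero>\<^bsub>residue_field K val\<^esub> \<longleftrightarrow> 0 < val x"
proof -
  interpret M: ideal M V by (rule maximalideal.axioms(1)[OF valuation_ideal_maximal])
  \<comment> \<open>The zero of the quotient is the coset \<open>M\<close> itself.\<close>
  have "residue K val x = M \<longleftrightarrow> x \<in> M"
    using assms M.a_rcos_const M.rcos_const_imp_mem unfolding residue_def by auto
  then show ?thesis
    using assms by (simp add: residue_field_def FactRing_def valuation_ideal_def)
qed

text \<open>Reduction is a homomorphism only on \<open>V\<close>, so the determinant is first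
  recomputed in \<open>V\<close> by way of the inclusion into \<open>K\<close>.\<close>

lemma residue_matrix_det:
  assumes "\<And>i j. \<lbrakk>i \<in> {1..n}; j \<in> {1..n}\<rbrakk> \<Longrightarrow> A i j \<in> carrier K \<and> 0 \<le> val (A i j)"
  shows "residue K val (matrix_det K n A) =
    matrix_det (residue_field K val) n (\<lambda>i j. residue K val (A i j))"
proof -
  have A: "A i (\<sigma> i) \<in> carrier V" if "\<sigma> \<in> {\<sigma>. \<sigma> permutes {1..n}}" "i \<in> {1..n}" for \<sigma> i
    using assms[of i "\<sigma> i"] that permutes_in_image[of \<sigma> "{1..n}" i] by simp
  have "id (matrix_det V n A) = matrix_det K n (\<lambda>i j. id (A i j))"
    unfolding matrix_det_def
    by (rule ring_hom_cring.hom_leibniz_sum[OF valuation_ring_inclusion A])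
  moreover have "residue K val (matrix_det V n A) =
      matrix_det (residue_field K val) n (\<lambda>i j. residue K val (A i j))"
    unfolding matrix_det_def
    by (rule ring_hom_cring.hom_leibniz_sum[OF residue_hom A])
  ultimately show ?thesis by simp
qed

end

section \<open>Nonvanishing of \<open>Theta4\<close> outside characteristic 3, and the
  determinant\<close>

lemma (in field) three_not_zero:
  assumes "ring_characteristic R \<noteq> 3"
  shows "[(3::int)] \<cdot> \<one> \<noteq> \<zero>"
proof
  assume "[(3::int)] \<cdot> \<one> = \<zero>"
  then have "int (add.ord \<one>) dvd 3"
    using add.int_pow_eq_id[of \<one> 3] by simp
  then have "add.ord \<one> dvd 3"
    by presburger
  \<comment> \<open>Infinite order is encoded as 0, and neither 0 nor 2 divides 3.\<close>
  then have "add.ord \<one> = 1 \<or> add.ord \<one> = 3"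
    using dvd_imp_le[of "add.ord \<one>" 3] by (cases "add.ord \<one> = 2"; cases "add.ord \<one> = 0") auto
  moreover have "add.ord \<one> \<noteq> 1"
    using add.ord_eq_1[of \<one>] by simp
  ultimately show False
    using assms by (simp add: ring_characteristic_def)
qed

lemma (in field) Theta4_rank_one_nonzero:
  assumes char: "ring_characteristic R \<noteq> 3"
    and unit: "\<And>i. i \<in> {1..4} \<Longrightarrow> \<alpha> i \<in> Units R \<and> \<beta> i \<in> Units R"
    and U: "\<And>i j. \<lbrakk>i \<in> {1..4}; j \<in> {1..4}; i \<noteq> j\<rbrakk> \<Longrightarrow> U i j = \<alpha> i \<otimes> \<beta> j"
  shows "Theta4 R U \<noteq> \<zero>"
proof -
  define P where "P = (\<Otimes>i\<in>{1..4}. \<alpha> i) \<otimes> (\<Otimes>i\<in>{1..4}. \<beta> i)"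
  have "finite (derangements 4)"
    by (rule finite_subset[OF _ finite_permutations[of "{1..4}"]]) (auto simp: derangements_def)
  then have "Theta4 R U = [sum sign (derangements 4)] \<cdot> P"
    unfolding Theta4_def P_def
  proof (rule leibniz_sum_rank_one)
    fix \<sigma> :: "nat \<Rightarrow> nat" and i :: nat assume "\<sigma> \<in> derangements 4" "i \<in> {1..4}"
    then show "U i (\<sigma> i) = \<alpha> i \<otimes> \<beta> (\<sigma> i)"
      using U[of i "\<sigma> i"] permutes_in_image[of \<sigma> "{1..4}" i]
      by (metis (mono_tags, lifting) derangements_def mem_Collect_eq)
  qed (use unit Units_closed in \<open>auto simp: derangements_def\<close>)
  then have Theta: "Theta4 R U = [(-3::int)] \<cdot> P"
    by (simp add: sum_sign_derangements_4)
  have prod_unit: "(\<Otimes>i\<in>I. g i) \<in> Units R" if "\<And>i. i \<in> I \<Longrightarrow> g i \<in> Units R"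
    for g :: "nat \<Rightarrow> 'a" and I :: "nat set"
    using that
    by (induction I rule: infinite_finite_induct) (auto simp: Units_closed Pi_def)
  have P: "P \<in> carrier R" "P \<noteq> \<zero>"
    using prod_unit[of "{1..4}" \<alpha>] prod_unit[of "{1..4}" \<beta>] unit field_Units
    by (auto simp: P_def integral_iff)
  \<comment> \<open>The characteristic speaks of multiples of 1 only, so the integer factor is moved
    onto 1.\<close>
  have "[(3::int)] \<cdot> P = ([(3::int)] \<cdot> \<one>) \<otimes> P"
    using P add_pow_ldistr_int[of \<one> P 3] by simp
  then have "[(3::int)] \<cdot> P \<noteq> \<zero>"
    using P three_not_zero[OF char] by (simp add: integral_iff)
  moreover have "[(-3::int)] \<cdot> P = \<ominus> ([(3::int)] \<cdot> P)"
    using P add.int_pow_neg[of P 3] by simp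
  ultimately show ?thesis
    using Theta P by (metis add.int_pow_closed minus_minus minus_zero)
qed

theorem theorem5p5:
  fixes K :: "('a, 'm) ring_scheme"
    and val :: "'a \<Rightarrow> ereal"
    and F :: "nat \<Rightarrow> nat \<Rightarrow> 'a"
    and k :: "'a set ring"
    and U :: "nat \<Rightarrow> nat \<Rightarrow> 'a set"
  defines "k \<equiv> residue_field K val"
    and "U \<equiv> \<lambda>i j. residue K val (F i j)"
  assumes "valued_field K val"
    and "ring_characteristic k \<noteq> 3"
    and "identity_pattern_lift K val F"
  shows "((\<forall>i j a b. admissible i j a b \<longrightarrow> cross_ratio k U i j a b = \<one>\<^bsub>k\<^esub>) \<longrightarrow>
            (\<exists>\<alpha> \<beta>. (\<forall>i\<in>{1..4}. \<alpha> i \<in> Units k \<and> \<beta> i \<in> Units k) \<and>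
                (\<forall>i\<in>{1..4}. \<forall>j\<in>{1..4}. i \<noteq> j \<longrightarrow> U i j = \<alpha> i \<otimes>\<^bsub>k\<^esub> \<beta> j)) \<and>
            Theta4 k U \<noteq> \<zero>\<^bsub>k\<^esub> \<and>
            matrix_det K 4 F \<noteq> \<zero>\<^bsub>K\<^esub>) \<and>
         (matrix_det K 4 F = \<zero>\<^bsub>K\<^esub> \<longrightarrow>
            (\<exists>i j a b. admissible i j a b \<and> cross_ratio k U i j a b \<noteq> \<one>\<^bsub>k\<^esub>))"
proof -
  interpret valued_field K val by fact
  interpret k: field k unfolding k_def by (rule residue_field_field)
  interpret res: ring_hom_cring V k "residue K val" unfolding k_def by (rule residue_hom)
  have F: "F i j \<in> carrier K \<and> val (F i j) = (if i = j then 1 else 0)"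
    if "i \<in> {1..4}" "j \<in> {1..4}" for i j
    using assms(5) that unfolding identity_pattern_lift_def by blast
  have U_carrier: "U i j \<in> carrier k" if "i \<in> {1..4}" "j \<in> {1..4}" for i j
    unfolding U_def using F[OF that] by (intro res.hom_closed) simp
  \<comment> \<open>The diagonal values 1 are positive and the off-diagonal values are 0, so exactly
    the diagonal reduces to zero.\<close>
  have U_zero: "U i j = \<zero>\<^bsub>k\<^esub> \<longleftrightarrow> i = j" if "i \<in> {1..4}" "j \<in> {1..4}" for i j
    unfolding U_def k_def using F[OF that] by (subst residue_eq_zero_iff) auto
  have "residue K val (matrix_det K 4 F) = matrix_det k 4 U"
    unfolding U_def k_def using F by (intro residue_matrix_det) auto
  also have "\<dots> = Theta4 k U"
    unfolding Theta4_def using U_carrier U_zero by (intro k.matrix_det_hollow) blast+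
  finally have det: "residue K val (matrix_det K 4 F) = Theta4 k U" .
  have main: "(\<exists>\<alpha> \<beta>. (\<forall>i\<in>{1..4}. \<alpha> i \<in> Units k \<and> \<beta> i \<in> Units k) \<and>
        (\<forall>i\<in>{1..4}. \<forall>j\<in>{1..4}. i \<noteq> j \<longrightarrow> U i j = \<alpha> i \<otimes>\<^bsub>k\<^esub> \<beta> j)) \<and>
      Theta4 k U \<noteq> \<zero>\<^bsub>k\<^esub> \<and> matrix_det K 4 F \<noteq> \<zero>\<^bsub>K\<^esub>"
    if cr: "\<forall>i j a b. admissible i j a b \<longrightarrow> cross_ratio k U i j a b = \<one>\<^bsub>k\<^esub>"
  proof -
    have "\<exists>\<alpha> \<beta>. (\<forall>i\<in>{1..4}. \<alpha> i \<in> Units k \<and> \<beta> i \<in> Units k) \<and>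
        (\<forall>i\<in>{1..4}. \<forall>j\<in>{1..4}. i \<noteq> j \<longrightarrow> U i j = \<alpha> i \<otimes>\<^bsub>k\<^esub> \<beta> j)"
      using U_carrier U_zero cr by (intro k.rank_one_off_diagonal) blast+
    moreover from this have "Theta4 k U \<noteq> \<zero>\<^bsub>k\<^esub>"
      using k.Theta4_rank_one_nonzero[OF assms(4)] by blast
    \<comment> \<open>A zero determinant would have zero residue, but that residue is
      \<open>Theta4 k U\<close>.\<close>
    moreover from this have "matrix_det K 4 F \<noteq> \<zero>\<^bsub>K\<^esub>"
      using det res.hom_zero by auto
    ultimately show ?thesis by blast
  qed
  \<comment> \<open>The second conjunct is the contrapositive of the determinant claim in
    \<open>main\<close>.\<close>
  then show ?thesis by blast
qed

end
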